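(* A quasi-classical generalized F structure $\Phi$ on a manifold $M$ is equivalent to a pair $(A,\pi)$, where $A\in End(TM)$ is an F structure and $\pi$ is a bivector field on $M$ that is $A$-compatible in the sense that $\pi_A$, defined by $\pi_A(\alpha,\beta)=\pi(A^*\alpha,\beta)$, is again a bivector field (i.e. is skew-symmetric) and $\mathrm{im}\,\sharp_\pi\subseteq \mathrm{im}\,A$. The correspondence between $\Phi$ and $(A,\pi)$ is given by $\Phi(X,\alpha)=(AX+\sharp_\pi\alpha,\,-A^*\alpha)$ for $X\in TM$, $\alpha\in T^*M$.
   Context: All manifolds and objects are $C^\infty$. $\mathbf{T}M=TM\oplus T^*M$ carries the pairing metric $g((X,\alpha),(Y,\beta))=\frac12(\alpha(Y)+\beta(X))$. For $A\in End(TM)$, $A^*\alpha=\alpha\circ A$. For a bivector field $\pi$, $\sharp_\pi\alpha=i(\alpha)\pi$, i.e. $\beta(\sharp_\pi\alpha)=\pi(\alpha,\beta)$. An F structure is $A\in End(TM)$ with $A^3+A=0$. A generalized F structure is an endomorphism $\Phi$ of $\mathbf{T}M$ that is $g$-skew-symmetric ($g(\Phi u,v)+g(u,\Phi v)=0$) and satisfies $\Phi^3+\Phi=0$. It is called quasi-classical if $\Phi(TM)\subseteq TM$ and $\Phi^2(T^*M)\subseteq T^*M$. *)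

theory Defs
  imports "HOL-Analysis.Analysis" "HOL-Library.Function_Algebras"
begin

section \<open>Linear maps between subspaces\<close>

text \<open>Fibres of vector bundles are linear subspaces of function types, with pointwise operations.\<close>

instantiation "fun" :: (type, real_vector) real_vector
begin

definition scaleR_fun :: "real \<Rightarrow> ('a \<Rightarrow> 'b) \<Rightarrow> 'a \<Rightarrow> 'b"
  where "scaleR_fun r f = (\<lambda>x. r *\<^sub>R f x)"

instance
  by standard (auto simp: scaleR_fun_def fun_eq_iff scaleR_add_right scaleR_add_left)

end

definition linear_between ::
    "'v::real_vector set \<Rightarrow> 'w::real_vector set \<Rightarrow> ('v \<Rightarrow> 'w) \<Rightarrow> bool"
  where "linear_between V W f \<longleftrightarrow>
    f ` V \<subseteq> W \<and>
    (\<forall>u\<in>V. \<forall>v\<in>V. f (u + v) = f u + f v) \<and>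
    (\<forall>r. \<forall>v\<in>V. f (r *\<^sub>R v) = r *\<^sub>R f v)"

section \<open>Smooth manifolds\<close>

text \<open>Only used on open subsets \<open>S\<close> of a finite-dimensional space, where it suffices to
  differentiate in each fixed direction.\<close>

primrec Ck_on ::
    "nat \<Rightarrow> 'e::real_normed_vector set \<Rightarrow> ('e \<Rightarrow> 'f::real_normed_vector) \<Rightarrow> bool"
  where
    "Ck_on 0 S f \<longleftrightarrow> continuous_on S f"
  | "Ck_on (Suc k) S f \<longleftrightarrow>
       (\<forall>x\<in>S. f differentiable (at x)) \<and>
       (\<forall>v. Ck_on k S (\<lambda>x. frechet_derivative f (at x) v))"

definition smooth_on ::
    "'e::real_normed_vector set \<Rightarrow> ('e \<Rightarrow> 'f::real_normed_vector) \<Rightarrow> bool"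
  where "smooth_on S f \<longleftrightarrow> (\<forall>k. Ck_on k S f)"

text \<open>A chart \<open>(U, \<phi>)\<close>; only the values of \<open>\<phi>\<close> on \<open>U\<close> matter.\<close>

type_synonym ('a, 'e) chart = "'a set \<times> ('a \<Rightarrow> 'e)"

abbreviation chart_inv :: "('a, 'e) chart \<Rightarrow> 'e \<Rightarrow> 'a"
  where "chart_inv c \<equiv> inv_into (fst c) (snd c)"

record ('a, 'e) manifold =
  mtop :: "'a topology"
  atlas :: "('a, 'e) chart set"

abbreviation points :: "('a, 'e) manifold \<Rightarrow> 'a set"
  where "points M \<equiv> topspace (mtop M)"

text \<open>The model space \<open>'e\<close> is an arbitrary finite-dimensional real normed space, so that every
  dimension, including 0, is covered. The atlas need not be maximal.\<close>

definition smooth_manifold :: "('a, 'e::real_normed_vector) manifold \<Rightarrow> bool"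
  where "smooth_manifold M \<longleftrightarrow>
    (\<exists>B::'e set. finite B \<and> span B = UNIV) \<and>
    Hausdorff_space (mtop M) \<and>
    second_countable (mtop M) \<and>
    (\<Union>c\<in>atlas M. fst c) = points M \<and>
    (\<forall>c\<in>atlas M. openin (mtop M) (fst c) \<and> open (snd c ` fst c) \<and>
      homeomorphic_map (subtopology (mtop M) (fst c)) (top_of_set (snd c ` fst c)) (snd c)) \<and>
    (\<forall>c\<in>atlas M. \<forall>d\<in>atlas M. smooth_on (snd c ` (fst c \<inter> fst d)) (snd d \<circ> chart_inv c))"

section \<open>Tangent and cotangent spaces\<close>

definition charts_at :: "('a, 'e) manifold \<Rightarrow> 'a \<Rightarrow> ('a, 'e) chart set"
  where "charts_at M p = {c \<in> atlas M. p \<in> fst c}"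

definition transition_deriv ::
    "('a, 'e::real_normed_vector) chart \<Rightarrow> ('a, 'e) chart \<Rightarrow> 'a \<Rightarrow> 'e \<Rightarrow> 'e"
  where "transition_deriv c d p = frechet_derivative (snd d \<circ> chart_inv c) (at (snd c p))"

text \<open>A tangent vector at \<open>p\<close> is the family of its coordinate representations in the charts
  around \<open>p\<close>, transforming by the derivatives of the chart changes.  Here and below, all maps are
  extended by 0 outside their natural domain, so that equality in HOL is equality on that domain.\<close>

type_synonym ('a, 'e) tvec = "('a, 'e) chart \<Rightarrow> 'e"
type_synonym ('a, 'e) covec = "('a, 'e) tvec \<Rightarrow> real"

definition tangent_space :: "('a, 'e::real_normed_vector) manifold \<Rightarrow> 'a \<Rightarrow> ('a, 'e) tvec set"
  where "tangent_space M p =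
    {v. (\<forall>c\<in>charts_at M p. \<forall>d\<in>charts_at M p. v d = transition_deriv c d p (v c)) \<and>
        (\<forall>c. c \<notin> charts_at M p \<longrightarrow> v c = 0)}"

definition cotangent_space :: "('a, 'e::real_normed_vector) manifold \<Rightarrow> 'a \<Rightarrow> ('a, 'e) covec set"
  where "cotangent_space M p =
    {\<alpha>. linear_between (tangent_space M p) UNIV \<alpha> \<and> (\<forall>v. v \<notin> tangent_space M p \<longrightarrow> \<alpha> v = 0)}"

definition big_tangent_space ::
    "('a, 'e::real_normed_vector) manifold \<Rightarrow> 'a \<Rightarrow> (('a, 'e) tvec \<times> ('a, 'e) covec) set"
  where "big_tangent_space M p = tangent_space M p \<times> cotangent_space M p"

section \<open>Smooth fields\<close>

text \<open>The local coordinate field \<open>\<partial>\<^sub>a\<close> of a chart \<open>c\<close> in the direction \<open>a\<close>, and the local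
  1-form \<open>d(l \<circ> \<phi>)\<close> of a linear coordinate \<open>l\<close>, where \<open>\<phi>\<close> is the map of \<open>c\<close>.\<close>

definition coord_vec ::
    "('a, 'e::real_normed_vector) manifold \<Rightarrow> ('a, 'e) chart \<Rightarrow> 'e \<Rightarrow> 'a \<Rightarrow> ('a, 'e) tvec"
  where "coord_vec M c a p = (\<lambda>d. if d \<in> charts_at M p then transition_deriv c d p a else 0)"

definition coord_covec ::
    "('a, 'e::real_normed_vector) manifold \<Rightarrow> ('a, 'e) chart \<Rightarrow> ('e \<Rightarrow> real) \<Rightarrow> 'a \<Rightarrow> ('a, 'e) covec"
  where "coord_covec M c l p = (\<lambda>v. if v \<in> tangent_space M p then l (v c) else 0)"

definition smooth_in_chart ::
    "('a, 'e::real_normed_vector) chart \<Rightarrow> ('a \<Rightarrow> real) \<Rightarrow> bool"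
  where "smooth_in_chart c f \<longleftrightarrow> smooth_on (snd c ` fst c) (f \<circ> chart_inv c)"

definition smooth_vector_field_in ::
    "('a, 'e::real_normed_vector) chart \<Rightarrow> ('a \<Rightarrow> ('a, 'e) tvec) \<Rightarrow> bool"
  where "smooth_vector_field_in c X \<longleftrightarrow>
    (\<forall>l. linear l \<longrightarrow> smooth_in_chart c (\<lambda>p. l (X p c)))"

definition smooth_one_form_in ::
    "('a, 'e::real_normed_vector) manifold \<Rightarrow> ('a, 'e) chart \<Rightarrow> ('a \<Rightarrow> ('a, 'e) covec) \<Rightarrow> bool"
  where "smooth_one_form_in M c \<omega> \<longleftrightarrow>
    (\<forall>a. smooth_in_chart c (\<lambda>p. \<omega> p (coord_vec M c a p)))"

definition smooth_big_section_in ::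
    "('a, 'e::real_normed_vector) manifold \<Rightarrow> ('a, 'e) chart \<Rightarrow>
     ('a \<Rightarrow> ('a, 'e) tvec \<times> ('a, 'e) covec) \<Rightarrow> bool"
  where "smooth_big_section_in M c s \<longleftrightarrow>
    smooth_vector_field_in c (\<lambda>p. fst (s p)) \<and> smooth_one_form_in M c (\<lambda>p. snd (s p))"

text \<open>Smoothness of bundle endomorphisms and bivector fields is smoothness of the images (or
  values) on the local coordinate frames, i.e. of all components in charts.\<close>

definition tangent_endo ::
    "('a, 'e::real_normed_vector) manifold \<Rightarrow> ('a \<Rightarrow> ('a, 'e) tvec \<Rightarrow> ('a, 'e) tvec) \<Rightarrow> bool"
  where "tangent_endo M A \<longleftrightarrow>
    (\<forall>p\<in>points M. linear_between (tangent_space M p) (tangent_space M p) (A p)) \<and>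
    (\<forall>p v. p \<notin> points M \<or> v \<notin> tangent_space M p \<longrightarrow> A p v = 0) \<and>
    (\<forall>c\<in>atlas M. \<forall>a. smooth_vector_field_in c (\<lambda>p. A p (coord_vec M c a p)))"

definition big_tangent_endo ::
    "('a, 'e::real_normed_vector) manifold \<Rightarrow>
     ('a \<Rightarrow> ('a, 'e) tvec \<times> ('a, 'e) covec \<Rightarrow> ('a, 'e) tvec \<times> ('a, 'e) covec) \<Rightarrow> bool"
  where "big_tangent_endo M \<Phi> \<longleftrightarrow>
    (\<forall>p\<in>points M. linear_between (big_tangent_space M p) (big_tangent_space M p) (\<Phi> p)) \<and>
    (\<forall>p u. p \<notin> points M \<or> u \<notin> big_tangent_space M p \<longrightarrow> \<Phi> p u = 0) \<and>
    (\<forall>c\<in>atlas M.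
      (\<forall>a. smooth_big_section_in M c (\<lambda>p. \<Phi> p (coord_vec M c a p, 0))) \<and>
      (\<forall>l. linear l \<longrightarrow> smooth_big_section_in M c (\<lambda>p. \<Phi> p (0, coord_covec M c l p))))"

definition bivector_field ::
    "('a, 'e::real_normed_vector) manifold \<Rightarrow>
     ('a \<Rightarrow> ('a, 'e) covec \<Rightarrow> ('a, 'e) covec \<Rightarrow> real) \<Rightarrow> bool"
  where "bivector_field M \<pi> \<longleftrightarrow>
    (\<forall>p\<in>points M. \<forall>\<alpha>\<in>cotangent_space M p.
      linear_between (cotangent_space M p) UNIV (\<pi> p \<alpha>) \<and>
      linear_between (cotangent_space M p) UNIV (\<lambda>\<beta>. \<pi> p \<beta> \<alpha>)) \<and>
    (\<forall>p\<in>points M. \<forall>\<alpha>\<in>cotangent_space M p. \<forall>\<beta>\<in>cotangent_space M p. \<pi> p \<alpha> \<beta> = - \<pi> p \<beta> \<alpha>) \<and>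
    (\<forall>p \<alpha> \<beta>. p \<notin> points M \<or> \<alpha> \<notin> cotangent_space M p \<or> \<beta> \<notin> cotangent_space M p \<longrightarrow>
      \<pi> p \<alpha> \<beta> = 0) \<and>
    (\<forall>c\<in>atlas M. \<forall>l m. linear l \<longrightarrow> linear m \<longrightarrow>
      smooth_in_chart c (\<lambda>p. \<pi> p (coord_covec M c l p) (coord_covec M c m p)))"

section \<open>F structures and generalized F structures\<close>

definition F_structure ::
    "('a, 'e::real_normed_vector) manifold \<Rightarrow> ('a \<Rightarrow> ('a, 'e) tvec \<Rightarrow> ('a, 'e) tvec) \<Rightarrow> bool"
  where "F_structure M A \<longleftrightarrow> tangent_endo M A \<and>
    (\<forall>p\<in>points M. \<forall>v\<in>tangent_space M p. A p (A p (A p v)) + A p v = 0)"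

definition pairing_metric ::
    "('a, 'e) tvec \<times> ('a, 'e) covec \<Rightarrow> ('a, 'e) tvec \<times> ('a, 'e) covec \<Rightarrow> real"
  where "pairing_metric u w = (snd u (fst w) + snd w (fst u)) / 2"

definition generalized_F_structure ::
    "('a, 'e::real_normed_vector) manifold \<Rightarrow>
     ('a \<Rightarrow> ('a, 'e) tvec \<times> ('a, 'e) covec \<Rightarrow> ('a, 'e) tvec \<times> ('a, 'e) covec) \<Rightarrow> bool"
  where "generalized_F_structure M \<Phi> \<longleftrightarrow> big_tangent_endo M \<Phi> \<and>
    (\<forall>p\<in>points M. \<forall>u\<in>big_tangent_space M p. \<forall>w\<in>big_tangent_space M p.
      pairing_metric (\<Phi> p u) w + pairing_metric u (\<Phi> p w) = 0) \<and>
    (\<forall>p\<in>points M. \<forall>u\<in>big_tangent_space M p. \<Phi> p (\<Phi> p (\<Phi> p u)) + \<Phi> p u = 0)"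

definition quasi_classical ::
    "('a, 'e::real_normed_vector) manifold \<Rightarrow>
     ('a \<Rightarrow> ('a, 'e) tvec \<times> ('a, 'e) covec \<Rightarrow> ('a, 'e) tvec \<times> ('a, 'e) covec) \<Rightarrow> bool"
  where "quasi_classical M \<Phi> \<longleftrightarrow>
    (\<forall>p\<in>points M.
      \<Phi> p ` (tangent_space M p \<times> {0}) \<subseteq> tangent_space M p \<times> {0} \<and>
      (\<Phi> p \<circ> \<Phi> p) ` ({0} \<times> cotangent_space M p) \<subseteq> {0} \<times> cotangent_space M p)"

section \<open>Bivector fields compatible with an endomorphism\<close>

text \<open>\<open>\<sharp>\<^sub>\<pi> \<alpha>\<close> is the tangent vector characterized by \<open>\<beta> (\<sharp>\<^sub>\<pi> \<alpha>) = \<pi> \<alpha> \<beta>\<close>; it exists and is unique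
  since the tangent spaces are finite-dimensional.\<close>

definition sharp ::
    "('a, 'e::real_normed_vector) manifold \<Rightarrow>
     ('a \<Rightarrow> ('a, 'e) covec \<Rightarrow> ('a, 'e) covec \<Rightarrow> real) \<Rightarrow> 'a \<Rightarrow> ('a, 'e) covec \<Rightarrow> ('a, 'e) tvec"
  where "sharp M \<pi> p \<alpha> =
    (THE v. v \<in> tangent_space M p \<and> (\<forall>\<beta>\<in>cotangent_space M p. \<beta> v = \<pi> p \<alpha> \<beta>))"

definition dual_map :: "('v \<Rightarrow> 'v) \<Rightarrow> ('v \<Rightarrow> real) \<Rightarrow> 'v \<Rightarrow> real"
  where "dual_map A \<alpha> = \<alpha> \<circ> A"

definition twisted_bivector ::
    "('a, 'e::real_normed_vector) manifold \<Rightarrow> ('a \<Rightarrow> ('a, 'e) tvec \<Rightarrow> ('a, 'e) tvec) \<Rightarrow>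
     ('a \<Rightarrow> ('a, 'e) covec \<Rightarrow> ('a, 'e) covec \<Rightarrow> real) \<Rightarrow>
     'a \<Rightarrow> ('a, 'e) covec \<Rightarrow> ('a, 'e) covec \<Rightarrow> real"
  where "twisted_bivector M A \<pi> p \<alpha> \<beta> =
    (if p \<in> points M \<and> \<alpha> \<in> cotangent_space M p \<and> \<beta> \<in> cotangent_space M p
     then \<pi> p (dual_map (A p) \<alpha>) \<beta> else 0)"

definition compatible_bivector ::
    "('a, 'e::real_normed_vector) manifold \<Rightarrow> ('a \<Rightarrow> ('a, 'e) tvec \<Rightarrow> ('a, 'e) tvec) \<Rightarrow>
     ('a \<Rightarrow> ('a, 'e) covec \<Rightarrow> ('a, 'e) covec \<Rightarrow> real) \<Rightarrow> bool"
  where "compatible_bivector M A \<pi> \<longleftrightarrow>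
    bivector_field M (twisted_bivector M A \<pi>) \<and>
    (\<forall>p\<in>points M. sharp M \<pi> p ` cotangent_space M p \<subseteq> A p ` tangent_space M p)"

definition endo_of_pair ::
    "('a, 'e::real_normed_vector) manifold \<Rightarrow> ('a \<Rightarrow> ('a, 'e) tvec \<Rightarrow> ('a, 'e) tvec) \<Rightarrow>
     ('a \<Rightarrow> ('a, 'e) covec \<Rightarrow> ('a, 'e) covec \<Rightarrow> real) \<Rightarrow>
     'a \<Rightarrow> ('a, 'e) tvec \<times> ('a, 'e) covec \<Rightarrow> ('a, 'e) tvec \<times> ('a, 'e) covec"
  where "endo_of_pair M A \<pi> p = (\<lambda>(X, \<alpha>).
    if p \<in> points M \<and> (X, \<alpha>) \<in> big_tangent_space M p
    then (A p X + sharp M \<pi> p \<alpha>, - dual_map (A p) \<alpha>) else 0)"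

end

theory Submission
  imports Defs
begin

text \<open>
  The correspondence reduces to linear algebra in each fibre.  If \<open>\<Phi>\<close> maps vectors to vectors, it has
  the block form \<open>\<Phi>(X, \<alpha>) = (A X + \<sigma> \<alpha>, \<rho> \<alpha>)\<close>, and skew-symmetry for the pairing metric says
  that \<open>\<rho> = - A\<^sup>*\<close> and that \<open>\<sigma> = \<sharp>\<^sub>\<pi>\<close> for the skew form \<open>\<pi>(\<alpha>, \<beta>) = \<beta>(\<sigma> \<alpha>)\<close>.  Hence
  \<open>\<Phi>\<^sup>2(X, \<alpha>) = (A\<^sup>2 X + A \<sigma> \<alpha> - \<sigma> A\<^sup>* \<alpha>, A\<^sup>*\<^sup>2 \<alpha>)\<close>.  The remaining conditions translate as follows.

  \<^item> \<open>\<Phi>\<^sup>2\<close> preserves the covectors iff \<open>A \<sigma> = \<sigma> A\<^sup>*\<close>, which by the skew-symmetry of \<open>\<pi>\<close> is the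
    skew-symmetry of \<open>\<pi>\<^sub>A\<close>.

  \<^item> Given this, \<open>\<Phi>\<^sup>3 + \<Phi> = 0\<close> iff \<open>A\<^sup>3 + A = 0\<close> and \<open>A\<^sup>2 \<sigma> = - \<sigma>\<close>.  For an F structure \<open>A\<close>
    the last equation is equivalent to \<open>im \<sigma> \<subseteq> im A\<close>, since \<open>A\<^sup>2 = - 1\<close> on the image of \<open>A\<close>.

  The two directions are \<open>generalized_F_structure_of_pair\<close> and \<open>pair_of_generalized_F_structure\<close>.

  Two points go beyond fibrewise algebra.  The existence of \<open>\<sharp>\<^sub>\<pi>\<close> is the reflexivity of the
  tangent spaces (\<open>tangent_reflexive\<close>), proved with the coordinate frame of a chart; that the
  coordinate fields are tangent vectors is the chain rule for chart changes.  The smoothness of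
  \<open>\<Phi>\<close>, \<open>A\<close> and \<open>\<pi>\<close> passes from one to the other componentwise, whereas that of \<open>\<pi>\<^sub>A\<close> needs the
  expansion of \<open>A\<^sup>* dl\<close> in the coordinate coframe, and with it sums and products of smooth functions.
\<close>

section \<open>Closure properties of smooth functions\<close>

lemma Ck_on_cong:
  assumes "open S" "\<And>x. x \<in> S \<Longrightarrow> f x = g x" "Ck_on k S f"
  shows "Ck_on k S g"
  using assms(2,3)
proof (induction k arbitrary: f g)
  case 0
  then show ?case by (metis Ck_on.simps(1) continuous_on_cong)
next
  case (Suc k)
  have "g differentiable at x" if "x \<in> S" for x
    using Suc.prems that \<open>open S\<close>
    by (metis Ck_on.simps(2) differentiable_def has_derivative_transform_within_open)
  moreover have "Ck_on k S (\<lambda>x. frechet_derivative g (at x) v)" for v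
  proof (rule Suc.IH)
    show "Ck_on k S (\<lambda>x. frechet_derivative f (at x) v)"
      using Suc.prems by simp
    show "frechet_derivative f (at x) v = frechet_derivative g (at x) v" if "x \<in> S" for x
      using frechet_derivative_transform_within_open[of f x S g] Suc.prems \<open>open S\<close> that by simp
  qed
  ultimately show ?case by simp
qed

lemma Ck_on_SucD: "Ck_on (Suc k) S f \<Longrightarrow> Ck_on k S f"
proof (induction k arbitrary: f)
  case 0
  then show ?case
    by (simp add: continuous_at_imp_continuous_on differentiable_imp_continuous_within)
next
  case (Suc k)
  have "Ck_on k S (\<lambda>x. frechet_derivative f (at x) v)" for v
    using Suc.prems by (intro Suc.IH) simp
  with Suc.prems show ?case by simp
qed

lemma Ck_on_zero: "Ck_on k S (\<lambda>x. 0)"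
  by (induction k) (simp_all add: frechet_derivative_const zero_fun_def)

lemma Ck_on_add:
  assumes "open S" "Ck_on k S f" "Ck_on k S g"
  shows "Ck_on k S (\<lambda>x. f x + g x)"
  using assms(2,3)
proof (induction k arbitrary: f g)
  case 0
  then show ?case by (simp add: continuous_on_add)
next
  case (Suc k)
  have "Ck_on k S (\<lambda>x. frechet_derivative (\<lambda>x. f x + g x) (at x) v)" for v
  proof (rule Ck_on_cong[OF \<open>open S\<close>])
    show "Ck_on k S (\<lambda>x. frechet_derivative f (at x) v + frechet_derivative g (at x) v)"
      using Suc by simp
    show "frechet_derivative f (at x) v + frechet_derivative g (at x) v
        = frechet_derivative (\<lambda>x. f x + g x) (at x) v" if "x \<in> S" for x
    proof -
      have "((\<lambda>x. f x + g x) has_derivative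
          (\<lambda>v. frechet_derivative f (at x) v + frechet_derivative g (at x) v)) (at x)"
        using Suc.prems that by (intro has_derivative_add) (simp_all flip: frechet_derivative_works)
      from frechet_derivative_at[OF this] show ?thesis by metis
    qed
  qed
  with Suc.prems show ?case by simp
qed

lemma Ck_on_mult:
  fixes f g :: "'e::real_normed_vector \<Rightarrow> real"
  assumes "open S" "Ck_on k S f" "Ck_on k S g"
  shows "Ck_on k S (\<lambda>x. f x * g x)"
  using assms(2,3)
proof (induction k arbitrary: f g)
  case 0
  then show ?case by (simp add: continuous_on_mult)
next
  case (Suc k)
  have "Ck_on k S (\<lambda>x. frechet_derivative (\<lambda>x. f x * g x) (at x) v)" for v
  proof (rule Ck_on_cong[OF \<open>open S\<close>])
    show "Ck_on k S (\<lambda>x. f x * frechet_derivative g (at x) v + frechet_derivative f (at x) v * g x)"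
      using Suc.prems Suc.IH Ck_on_SucD[OF Suc.prems(1)] Ck_on_SucD[OF Suc.prems(2)]
      by (intro Ck_on_add[OF \<open>open S\<close>]) simp_all
    show "f x * frechet_derivative g (at x) v + frechet_derivative f (at x) v * g x
        = frechet_derivative (\<lambda>x. f x * g x) (at x) v" if "x \<in> S" for x
    proof -
      have "((\<lambda>x. f x * g x) has_derivative (\<lambda>v. f x * frechet_derivative g (at x) v
          + frechet_derivative f (at x) v * g x)) (at x)"
        using Suc.prems that by (intro has_derivative_mult) (simp_all flip: frechet_derivative_works)
      from frechet_derivative_at[OF this] show ?thesis by metis
    qed
  qed
  with Suc.prems show ?case by (simp add: differentiable_mult)
qed

lemma smooth_in_chart_cong:
  assumes "open (snd c ` fst c)" "\<And>p. p \<in> fst c \<Longrightarrow> f p = g p" "smooth_in_chart c f"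
  shows "smooth_in_chart c g"
  unfolding smooth_in_chart_def smooth_on_def
proof
  show "Ck_on k (snd c ` fst c) (g \<circ> chart_inv c)" for k
  proof (rule Ck_on_cong[OF assms(1)])
    show "Ck_on k (snd c ` fst c) (f \<circ> chart_inv c)"
      using assms(3) by (simp add: smooth_in_chart_def smooth_on_def)
    show "(f \<circ> chart_inv c) x = (g \<circ> chart_inv c) x" if "x \<in> snd c ` fst c" for x
      using assms(2)[OF inv_into_into[OF that]] by simp
  qed
qed

lemma smooth_in_chart_mult:
  assumes "open (snd c ` fst c)" "smooth_in_chart c f" "smooth_in_chart c g"
  shows "smooth_in_chart c (\<lambda>p. f p * g p)"
  using assms by (auto simp: smooth_in_chart_def smooth_on_def comp_def intro: Ck_on_mult)

lemma smooth_in_chart_sum: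
  assumes "open (snd c ` fst c)" "\<And>b. b \<in> B \<Longrightarrow> smooth_in_chart c (f b)"
  shows "smooth_in_chart c (\<lambda>p. \<Sum>b\<in>B. f b p)"
  using assms(2)
proof (induction B rule: infinite_finite_induct)
  case (insert b B)
  then show ?case
    using assms(1) by (auto simp: smooth_in_chart_def smooth_on_def comp_def intro: Ck_on_add)
qed (simp_all add: smooth_in_chart_def smooth_on_def comp_def Ck_on_zero)

section \<open>Linear maps\<close>

lemma scaleR_apply: "(r *\<^sub>R f) x = r *\<^sub>R f x"
  by (simp add: scaleR_fun_def)

lemma linear_between_add:
  "linear_between V W f \<Longrightarrow> u \<in> V \<Longrightarrow> v \<in> V \<Longrightarrow> f (u + v) = f u + f v"
  by (simp add: linear_between_def)

lemma linear_between_scale: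
  "linear_between V W f \<Longrightarrow> v \<in> V \<Longrightarrow> f (r *\<^sub>R v) = r *\<^sub>R f v"
  by (simp add: linear_between_def)

lemma linear_between_mem: "linear_between V W f \<Longrightarrow> v \<in> V \<Longrightarrow> f v \<in> W"
  by (auto simp: linear_between_def)

lemma linear_between_zero:
  assumes "linear_between V W f" "subspace V"
  shows "f 0 = 0"
  using linear_between_scale[OF assms(1), of 0 0] subspace_0[OF assms(2)] by simp

lemma linear_between_sum:
  assumes "linear_between V W f" "subspace V" "\<And>b. b \<in> B \<Longrightarrow> g b \<in> V"
  shows "f (\<Sum>b\<in>B. g b) = (\<Sum>b\<in>B. f (g b))"
  using assms(3)
proof (induction B rule: infinite_finite_induct)
  case (insert b B)
  then have "f (g b + sum g B) = f (g b) + f (sum g B)"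
    by (intro linear_between_add[OF assms(1)] subspace_sum[OF assms(2)]) auto
  with insert show ?case by simp
qed (simp_all add: linear_between_zero[OF assms(1,2)])

text \<open>A finite-dimensional space has a finite basis together with its coordinate functionals
  \<open>r b\<close>.\<close>

lemma finite_dual_basis:
  fixes B :: "'v::real_vector set"
  assumes "finite B" "span B = UNIV"
  obtains C and r :: "'v \<Rightarrow> 'v \<Rightarrow> real" where
    "finite C" "\<And>b. linear (r b)" "\<And>x. x = (\<Sum>b\<in>C. r b x *\<^sub>R b)"
proof -
  obtain C where C: "C \<subseteq> B" "independent C" "B \<subseteq> span C"
    using maximal_independent_subset by blast
  have span: "span C = UNIV"
    using C(3) assms(2) span_minimal[of B "span C"] by auto
  have fin: "finite C"
    using C(1) assms(1) finite_subset by blast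
  show thesis
  proof (rule that[of C "\<lambda>b x. representation C x b"])
    show "linear (\<lambda>x. representation C x b)" for b
      using C(2) span by (intro linearI) (simp_all add: representation_add representation_scale)
    show "x = (\<Sum>b\<in>C. representation C x b *\<^sub>R b)" for x
      using sum_representation_eq[OF C(2) _ fin] span by auto
  qed (fact fin)
qed

section \<open>Coordinate frames and reflexivity of the tangent spaces\<close>

context
  fixes M :: "('a, 'e::real_normed_vector) manifold"
  assumes M: "smooth_manifold M"
begin

lemma charts_at_iff: "c \<in> charts_at M p \<longleftrightarrow> c \<in> atlas M \<and> p \<in> fst c"
  by (simp add: charts_at_def)

lemma points_eq_Union_charts: "points M = (\<Union>c\<in>atlas M. fst c)"
  using M by (simp add: smooth_manifold_def)

lemma chart_at_exists: "p \<in> points M \<Longrightarrow> \<exists>c. c \<in> charts_at M p"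
  by (auto simp: points_eq_Union_charts charts_at_iff)

lemma chart_subset_points: "c \<in> atlas M \<Longrightarrow> p \<in> fst c \<Longrightarrow> p \<in> points M"
  by (auto simp: points_eq_Union_charts)

lemma openin_chart: "c \<in> atlas M \<Longrightarrow> openin (mtop M) (fst c)"
  using M by (simp add: smooth_manifold_def)

lemma open_chart_image: "c \<in> atlas M \<Longrightarrow> open (snd c ` fst c)"
  using M by (simp add: smooth_manifold_def)

lemma homeomorphic_chart:
  "c \<in> atlas M \<Longrightarrow>
    homeomorphic_map (subtopology (mtop M) (fst c)) (top_of_set (snd c ` fst c)) (snd c)"
  using M by (simp add: smooth_manifold_def)

lemma smooth_transition:
  "c \<in> atlas M \<Longrightarrow> d \<in> atlas M \<Longrightarrow>
    smooth_on (snd c ` (fst c \<inter> fst d)) (snd d \<circ> chart_inv c)"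
  using M by (simp add: smooth_manifold_def)

lemma inj_on_chart:
  assumes "c \<in> atlas M" shows "inj_on (snd c) (fst c)"
proof -
  have "topspace (subtopology (mtop M) (fst c)) = fst c"
    using openin_subset[OF openin_chart[OF assms]] by auto
  then show ?thesis
    using homeomorphic_imp_injective_map[OF homeomorphic_chart[OF assms]] by metis
qed

lemma open_chart_image_Int:
  assumes "c \<in> atlas M" "d \<in> atlas M" shows "open (snd c ` (fst c \<inter> fst d))"
proof -
  have "openin (subtopology (mtop M) (fst c)) (fst c \<inter> fst d)"
    using openin_chart[OF assms(2)] by (rule openin_subtopology_Int2)
  then have "openin (top_of_set (snd c ` fst c)) (snd c ` (fst c \<inter> fst d))"
    using homeomorphic_imp_open_map[OF homeomorphic_chart[OF assms(1)]]
    by (simp add: open_map_def)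
  then show ?thesis
    using open_chart_image[OF assms(1)] openin_open_trans by blast
qed

lemma transition_has_derivative:
  assumes "c \<in> charts_at M p" "d \<in> charts_at M p"
  shows "((snd d \<circ> chart_inv c) has_derivative transition_deriv c d p) (at (snd c p))"
proof -
  have "smooth_on (snd c ` (fst c \<inter> fst d)) (snd d \<circ> chart_inv c)"
    using smooth_transition assms by (simp add: charts_at_iff)
  then have "Ck_on (Suc 0) (snd c ` (fst c \<inter> fst d)) (snd d \<circ> chart_inv c)"
    unfolding smooth_on_def by blast
  then have "(snd d \<circ> chart_inv c) differentiable at (snd c p)"
    using assms unfolding charts_at_iff by simp
  then show ?thesis
    unfolding transition_deriv_def using frechet_derivative_works by blast
qed

lemma linear_transition_deriv:
  "c \<in> charts_at M p \<Longrightarrow> d \<in> charts_at M p \<Longrightarrow> linear (transition_deriv c d p)"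
  using transition_has_derivative has_derivative_linear by blast

lemma transition_deriv_self:
  assumes "c \<in> charts_at M p" shows "transition_deriv c c p = id"
proof -
  have c: "c \<in> atlas M" "p \<in> fst c" using assms by (auto simp: charts_at_iff)
  have "((snd c \<circ> chart_inv c) has_derivative id) (at (snd c p))"
  proof (rule has_derivative_transform_within_open[of id id])
    show "(id has_derivative id) (at (snd c p))" by (simp add: id_def)
    show "open (snd c ` fst c)" using open_chart_image c by blast
  qed (use c in \<open>auto simp: f_inv_into_f\<close>)
  then show ?thesis
    using transition_has_derivative[OF assms assms] has_derivative_unique by blast
qed

text \<open>The chain rule on the open overlap of the charts \<open>c\<close> and \<open>d\<close>.\<close>

lemma transition_deriv_comp:
  assumes "c \<in> charts_at M p" "d \<in> charts_at M p" "e \<in> charts_at M p"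
  shows "transition_deriv d e p (transition_deriv c d p a) = transition_deriv c e p a"
proof -
  have c: "c \<in> atlas M" "p \<in> fst c" and d: "d \<in> atlas M" "p \<in> fst d"
    using assms by (auto simp: charts_at_iff)
  have "(snd d \<circ> chart_inv c) (snd c p) = snd d p"
    using c inj_on_chart by simp
  then have "((snd e \<circ> chart_inv d) \<circ> (snd d \<circ> chart_inv c) has_derivative
      transition_deriv d e p \<circ> transition_deriv c d p) (at (snd c p))"
    using transition_has_derivative assms by (intro diff_chain_at) auto
  then have "((snd e \<circ> chart_inv c) has_derivative
      transition_deriv d e p \<circ> transition_deriv c d p) (at (snd c p))"
  proof (rule has_derivative_transform_within_open)
    show "open (snd c ` (fst c \<inter> fst d))"
      using open_chart_image_Int c d by blast
    show "snd c p \<in> snd c ` (fst c \<inter> fst d)" using c d by blast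
    fix x assume "x \<in> snd c ` (fst c \<inter> fst d)"
    then obtain q where "q \<in> fst c" "q \<in> fst d" "x = snd c q" by blast
    then show "((snd e \<circ> chart_inv d) \<circ> (snd d \<circ> chart_inv c)) x = (snd e \<circ> chart_inv c) x"
      using inj_on_chart c d by simp
  qed
  then have "transition_deriv d e p \<circ> transition_deriv c d p = transition_deriv c e p"
    using transition_has_derivative[OF assms(1,3)] has_derivative_unique by blast
  then show ?thesis by (metis comp_apply)
qed

lemma tangentI:
  assumes "\<And>c d. c \<in> charts_at M p \<Longrightarrow> d \<in> charts_at M p \<Longrightarrow> v d = transition_deriv c d p (v c)"
    "\<And>c. c \<notin> charts_at M p \<Longrightarrow> v c = 0"
  shows "v \<in> tangent_space M p"
  using assms unfolding tangent_space_def by blast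

lemma tangent_transition:
  "v \<in> tangent_space M p \<Longrightarrow> c \<in> charts_at M p \<Longrightarrow> d \<in> charts_at M p \<Longrightarrow>
    v d = transition_deriv c d p (v c)"
  unfolding tangent_space_def by blast

lemma tangent_outside: "v \<in> tangent_space M p \<Longrightarrow> c \<notin> charts_at M p \<Longrightarrow> v c = 0"
  unfolding tangent_space_def by blast

lemma subspace_tangent: "subspace (tangent_space M p)"
proof (rule subspaceI)
  show "0 \<in> tangent_space M p"
    by (rule tangentI) (simp_all add: linear_0 linear_transition_deriv)
next
  fix v w assume v: "v \<in> tangent_space M p" and w: "w \<in> tangent_space M p"
  show "v + w \<in> tangent_space M p"
  proof (rule tangentI)
    fix c d assume c: "c \<in> charts_at M p" and d: "d \<in> charts_at M p"
    show "(v + w) d = transition_deriv c d p ((v + w) c)"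
      using tangent_transition[OF v c d] tangent_transition[OF w c d]
      by (simp add: linear_add[OF linear_transition_deriv[OF c d]])
  qed (simp add: tangent_outside[OF v] tangent_outside[OF w])
next
  fix r v assume v: "v \<in> tangent_space M p"
  show "r *\<^sub>R v \<in> tangent_space M p"
  proof (rule tangentI)
    fix c d assume c: "c \<in> charts_at M p" and d: "d \<in> charts_at M p"
    show "(r *\<^sub>R v) d = transition_deriv c d p ((r *\<^sub>R v) c)"
      using tangent_transition[OF v c d]
      by (simp add: scaleR_fun_def linear_scale[OF linear_transition_deriv[OF c d]])
  qed (simp add: scaleR_fun_def tangent_outside[OF v])
qed

lemma subspace_cotangent: "subspace (cotangent_space M p)"
proof (rule subspaceI)
  show "0 \<in> cotangent_space M p"
    by (simp add: cotangent_space_def linear_between_def)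
  show "\<alpha> + \<beta> \<in> cotangent_space M p"
    if "\<alpha> \<in> cotangent_space M p" "\<beta> \<in> cotangent_space M p" for \<alpha> \<beta>
    using that unfolding cotangent_space_def linear_between_def by (simp add: algebra_simps)
  show "r *\<^sub>R \<alpha> \<in> cotangent_space M p" if "\<alpha> \<in> cotangent_space M p" for r \<alpha>
    using that unfolding cotangent_space_def linear_between_def
    by (simp add: scaleR_fun_def algebra_simps)
qed

lemma covec_linear:
  "\<alpha> \<in> cotangent_space M p \<Longrightarrow> linear_between (tangent_space M p) UNIV \<alpha>"
  by (simp add: cotangent_space_def)

lemma covec_eqI:
  assumes "\<alpha> \<in> cotangent_space M p" "\<beta> \<in> cotangent_space M p"
    "\<And>v. v \<in> tangent_space M p \<Longrightarrow> \<alpha> v = \<beta> v"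
  shows "\<alpha> = \<beta>"
proof
  show "\<alpha> v = \<beta> v" for v
    using assms by (cases "v \<in> tangent_space M p") (simp_all add: cotangent_space_def)
qed

lemma coord_vec_tangent:
  assumes "c \<in> charts_at M p" shows "coord_vec M c a p \<in> tangent_space M p"
proof (rule tangentI)
  fix d e assume "d \<in> charts_at M p" "e \<in> charts_at M p"
  then show "coord_vec M c a p e = transition_deriv d e p (coord_vec M c a p d)"
    by (simp add: coord_vec_def transition_deriv_comp[OF assms])
qed (simp add: coord_vec_def)

lemma coord_vec_self: "c \<in> charts_at M p \<Longrightarrow> coord_vec M c a p c = a"
  by (simp add: coord_vec_def transition_deriv_self)

lemma tangent_eq_coord_vec:
  assumes "c \<in> charts_at M p" "v \<in> tangent_space M p"
  shows "v = coord_vec M c (v c) p"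
proof
  show "v d = coord_vec M c (v c) p d" for d
    using tangent_transition[OF assms(2,1)] tangent_outside[OF assms(2)]
    by (cases "d \<in> charts_at M p") (simp_all add: coord_vec_def)
qed

lemma tangent_eqI:
  assumes "c \<in> charts_at M p" "v \<in> tangent_space M p" "w \<in> tangent_space M p" "v c = w c"
  shows "v = w"
  using tangent_eq_coord_vec assms by metis

lemma coord_covec_cotangent:
  assumes "linear l" shows "coord_covec M c l p \<in> cotangent_space M p"
  unfolding cotangent_space_def linear_between_def coord_covec_def
  by (simp add: subspace_add[OF subspace_tangent] subspace_scale[OF subspace_tangent]
      linear_add[OF assms] linear_scale[OF assms] scaleR_apply)

lemma coord_covec_apply: "v \<in> tangent_space M p \<Longrightarrow> coord_covec M c l p v = l (v c)"
  by (simp add: coord_covec_def)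

lemma coord_vec_sum:
  assumes "c \<in> charts_at M p"
  shows "coord_vec M c (\<Sum>b\<in>B. r b *\<^sub>R b) p = (\<Sum>b\<in>B. r b *\<^sub>R coord_vec M c b p)"
proof (rule tangent_eqI[OF assms])
  show "(\<Sum>b\<in>B. r b *\<^sub>R coord_vec M c b p) \<in> tangent_space M p"
    by (intro subspace_sum subspace_scale subspace_tangent coord_vec_tangent assms)
  have "(\<Sum>b\<in>B. r b *\<^sub>R coord_vec M c b p) c = (\<Sum>b\<in>B. r b *\<^sub>R coord_vec M c b p c)"
    by (induction B rule: infinite_finite_induct) (simp_all add: scaleR_fun_def)
  then show "coord_vec M c (\<Sum>b\<in>B. r b *\<^sub>R b) p c = (\<Sum>b\<in>B. r b *\<^sub>R coord_vec M c b p) c"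
    by (simp add: coord_vec_self assms)
qed (rule coord_vec_tangent[OF assms])

text \<open>A 1-form is the combination of coordinate differentials whose coefficients are its values on
  the coordinate fields.\<close>

lemma covec_eq_sum:
  assumes c: "c \<in> charts_at M p" and \<alpha>: "\<alpha> \<in> cotangent_space M p"
    and r: "\<And>b. linear (r b)" "\<And>x. x = (\<Sum>b\<in>B. r b x *\<^sub>R b)"
  shows "\<alpha> = (\<Sum>b\<in>B. \<alpha> (coord_vec M c b p) *\<^sub>R coord_covec M c (r b) p)"
proof (rule covec_eqI[OF \<alpha>])
  show "(\<Sum>b\<in>B. \<alpha> (coord_vec M c b p) *\<^sub>R coord_covec M c (r b) p) \<in> cotangent_space M p"
    by (intro subspace_sum subspace_scale subspace_cotangent coord_covec_cotangent r)
  fix v assume v: "v \<in> tangent_space M p"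
  have "v = coord_vec M c (v c) p"
    by (rule tangent_eq_coord_vec[OF c v])
  also have "\<dots> = coord_vec M c (\<Sum>b\<in>B. r b (v c) *\<^sub>R b) p"
    by (rule arg_cong[where f = "\<lambda>a. coord_vec M c a p", OF r(2)])
  also have "\<dots> = (\<Sum>b\<in>B. r b (v c) *\<^sub>R coord_vec M c b p)"
    by (rule coord_vec_sum[OF c])
  finally have v_eq: "v = (\<Sum>b\<in>B. r b (v c) *\<^sub>R coord_vec M c b p)" .
  have "\<alpha> v = \<alpha> (\<Sum>b\<in>B. r b (v c) *\<^sub>R coord_vec M c b p)"
    by (rule arg_cong[where f = \<alpha>, OF v_eq])
  also have "\<dots> = (\<Sum>b\<in>B. r b (v c) * \<alpha> (coord_vec M c b p))"
    by (subst linear_between_sum[OF covec_linear[OF \<alpha>] subspace_tangent])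
      (simp_all add: subspace_scale subspace_tangent coord_vec_tangent c
        linear_between_scale[OF covec_linear[OF \<alpha>]])
  also have "\<dots> = (\<Sum>b\<in>B. (\<alpha> (coord_vec M c b p) *\<^sub>R coord_covec M c (r b) p) v)"
    by (simp add: scaleR_fun_def coord_covec_apply[OF v] mult.commute)
  also have "\<dots> = (\<Sum>b\<in>B. \<alpha> (coord_vec M c b p) *\<^sub>R coord_covec M c (r b) p) v"
    by (induction B rule: infinite_finite_induct) simp_all
  finally show "\<alpha> v = (\<Sum>b\<in>B. \<alpha> (coord_vec M c b p) *\<^sub>R coord_covec M c (r b) p) v" .
qed

lemma model_dual_basis:
  obtains C and r :: "'e \<Rightarrow> 'e \<Rightarrow> real" where
    "finite C" "\<And>b. linear (r b)" "\<And>x. x = (\<Sum>b\<in>C. r b x *\<^sub>R b)"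
proof -
  obtain B :: "'e set" where "finite B" "span B = UNIV"
    using M unfolding smooth_manifold_def by blast
  then show thesis by (rule finite_dual_basis) (rule that)
qed

lemma tangent_eqI_covec:
  assumes p: "p \<in> points M" and v: "v \<in> tangent_space M p" and w: "w \<in> tangent_space M p"
    and eq: "\<And>\<beta>. \<beta> \<in> cotangent_space M p \<Longrightarrow> \<beta> v = \<beta> w"
  shows "v = w"
proof -
  obtain c where c: "c \<in> charts_at M p" using chart_at_exists[OF p] by blast
  obtain B and r :: "'e \<Rightarrow> 'e \<Rightarrow> real"
    where "finite B" and r: "\<And>b. linear (r b)" "\<And>x. x = (\<Sum>b\<in>B. r b x *\<^sub>R b)"
    by (rule model_dual_basis) (rule that)
  have comp: "r b (v c) = r b (w c)" for b
    using eq[OF coord_covec_cotangent[OF r(1)], of c b] v w by (simp add: coord_covec_apply)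
  have "v c = (\<Sum>b\<in>B. r b (v c) *\<^sub>R b)" by (rule r(2))
  also have "\<dots> = (\<Sum>b\<in>B. r b (w c) *\<^sub>R b)" by (simp only: comp)
  also have "\<dots> = w c" by (rule r(2)[symmetric])
  finally show ?thesis by (rule tangent_eqI[OF c v w])
qed

text \<open>Every functional on the cotangent space is evaluation at a tangent vector, namely at
  \<open>\<Sum>\<^sub>b F(dx\<^sub>b) \<partial>\<^sub>b\<close> for any chart around the point.\<close>

lemma tangent_reflexive:
  assumes p: "p \<in> points M" and F: "linear_between (cotangent_space M p) UNIV F"
  shows "\<exists>v\<in>tangent_space M p. \<forall>\<beta>\<in>cotangent_space M p. \<beta> v = (F \<beta> :: real)"
proof -
  obtain c where c: "c \<in> charts_at M p" using chart_at_exists[OF p] by blast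
  obtain B and r :: "'e \<Rightarrow> 'e \<Rightarrow> real"
    where "finite B" and r: "\<And>b. linear (r b)" "\<And>x. x = (\<Sum>b\<in>B. r b x *\<^sub>R b)"
    by (rule model_dual_basis) (rule that)
  let ?v = "\<Sum>b\<in>B. F (coord_covec M c (r b) p) *\<^sub>R coord_vec M c b p"
  have v: "?v \<in> tangent_space M p"
    by (intro subspace_sum subspace_scale subspace_tangent coord_vec_tangent c)
  have "\<beta> ?v = F \<beta>" if \<beta>: "\<beta> \<in> cotangent_space M p" for \<beta>
  proof -
    have "\<beta> ?v = (\<Sum>b\<in>B. F (coord_covec M c (r b) p) * \<beta> (coord_vec M c b p))"
      by (subst linear_between_sum[OF covec_linear[OF \<beta>] subspace_tangent])
        (simp_all add: subspace_scale subspace_tangent coord_vec_tangent c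
          linear_between_scale[OF covec_linear[OF \<beta>]])
    also have "\<dots> = F (\<Sum>b\<in>B. \<beta> (coord_vec M c b p) *\<^sub>R coord_covec M c (r b) p)"
      by (subst linear_between_sum[OF F subspace_cotangent])
        (simp_all add: subspace_scale subspace_cotangent coord_covec_cotangent r(1)
          linear_between_scale[OF F] mult.commute)
    also have "\<dots> = F \<beta>" using covec_eq_sum[OF c \<beta> r] by simp
    finally show ?thesis .
  qed
  with v show ?thesis by blast
qed

lemma tangent_minus: "v \<in> tangent_space M p \<Longrightarrow> - v \<in> tangent_space M p"
  by (rule subspace_neg[OF subspace_tangent])

lemma cotangent_minus: "\<alpha> \<in> cotangent_space M p \<Longrightarrow> - \<alpha> \<in> cotangent_space M p"
  by (rule subspace_neg[OF subspace_cotangent])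

lemma tangent_zero: "0 \<in> tangent_space M p"
  by (rule subspace_0[OF subspace_tangent])

lemma cotangent_zero: "0 \<in> cotangent_space M p"
  by (rule subspace_0[OF subspace_cotangent])

lemma covec_zero: "\<alpha> \<in> cotangent_space M p \<Longrightarrow> \<alpha> 0 = 0"
  by (rule linear_between_zero[OF covec_linear subspace_tangent])

lemma big_tangent_iff:
  "(v, \<alpha>) \<in> big_tangent_space M p \<longleftrightarrow> v \<in> tangent_space M p \<and> \<alpha> \<in> cotangent_space M p"
  by (simp add: big_tangent_space_def)

lemma smooth_in_chart_transfer:
  assumes "c \<in> atlas M" "smooth_in_chart c f"
    "\<And>p. c \<in> charts_at M p \<Longrightarrow> p \<in> points M \<Longrightarrow> f p = g p"
  shows "smooth_in_chart c g"
  using smooth_in_chart_cong[OF open_chart_image[OF assms(1)] _ assms(2)] assms(1,3)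
    chart_subset_points by (simp add: charts_at_iff)

section \<open>Bivectors, musical maps and dual maps\<close>

lemma bivector_linear_right:
  "bivector_field M \<pi> \<Longrightarrow> p \<in> points M \<Longrightarrow> \<alpha> \<in> cotangent_space M p \<Longrightarrow>
    linear_between (cotangent_space M p) UNIV (\<pi> p \<alpha>)"
  by (simp add: bivector_field_def)

lemma bivector_linear_left:
  "bivector_field M \<pi> \<Longrightarrow> p \<in> points M \<Longrightarrow> \<alpha> \<in> cotangent_space M p \<Longrightarrow>
    linear_between (cotangent_space M p) UNIV (\<lambda>\<beta>. \<pi> p \<beta> \<alpha>)"
  by (simp add: bivector_field_def)

lemma bivector_skew:
  assumes "bivector_field M \<pi>" "p \<in> points M" "\<alpha> \<in> cotangent_space M p" "\<beta> \<in> cotangent_space M p"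
  shows "\<pi> p \<alpha> \<beta> = - \<pi> p \<beta> \<alpha>"
  using assms unfolding bivector_field_def by blast

lemma bivector_outside:
  "bivector_field M \<pi> \<Longrightarrow> p \<notin> points M \<or> \<alpha> \<notin> cotangent_space M p \<or> \<beta> \<notin> cotangent_space M p \<Longrightarrow>
    \<pi> p \<alpha> \<beta> = 0"
  unfolding bivector_field_def by blast

lemma bivector_smooth:
  "bivector_field M \<pi> \<Longrightarrow> c \<in> atlas M \<Longrightarrow> linear l \<Longrightarrow> linear m \<Longrightarrow>
    smooth_in_chart c (\<lambda>p. \<pi> p (coord_covec M c l p) (coord_covec M c m p))"
  by (simp add: bivector_field_def)

lemma sharp_eqI:
  assumes "p \<in> points M" "v \<in> tangent_space M p"
    "\<And>\<beta>. \<beta> \<in> cotangent_space M p \<Longrightarrow> \<beta> v = \<pi> p \<alpha> \<beta>"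
  shows "sharp M \<pi> p \<alpha> = v"
  unfolding sharp_def
proof (rule the_equality)
  show "w = v"
    if "w \<in> tangent_space M p \<and> (\<forall>\<beta>\<in>cotangent_space M p. \<beta> w = \<pi> p \<alpha> \<beta>)" for w
    using that assms by (intro tangent_eqI_covec[OF assms(1)]) simp_all
qed (use assms in simp)

lemma sharp_props:
  assumes "bivector_field M \<pi>" "p \<in> points M" "\<alpha> \<in> cotangent_space M p"
  shows "sharp M \<pi> p \<alpha> \<in> tangent_space M p \<and>
    (\<forall>\<beta>\<in>cotangent_space M p. \<beta> (sharp M \<pi> p \<alpha>) = \<pi> p \<alpha> \<beta>)"
proof -
  obtain v where "v \<in> tangent_space M p" "\<forall>\<beta>\<in>cotangent_space M p. \<beta> v = \<pi> p \<alpha> \<beta>"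
    using tangent_reflexive[OF assms(2) bivector_linear_right[OF assms]] by blast
  moreover from this have "sharp M \<pi> p \<alpha> = v"
    by (intro sharp_eqI[OF assms(2)]) simp_all
  ultimately show ?thesis by simp
qed

lemmas sharp_tangent = sharp_props[THEN conjunct1]
lemmas covec_sharp = sharp_props[THEN conjunct2, THEN bspec]

lemma sharp_linear:
  assumes \<pi>: "bivector_field M \<pi>" and p: "p \<in> points M"
  shows "linear_between (cotangent_space M p) (tangent_space M p) (sharp M \<pi> p)"
  unfolding linear_between_def
proof (intro conjI ballI allI)
  show "sharp M \<pi> p ` cotangent_space M p \<subseteq> tangent_space M p"
    using sharp_tangent[OF assms] by blast
next
  fix \<alpha> \<beta> assume \<alpha>: "\<alpha> \<in> cotangent_space M p" and \<beta>: "\<beta> \<in> cotangent_space M p"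
  show "sharp M \<pi> p (\<alpha> + \<beta>) = sharp M \<pi> p \<alpha> + sharp M \<pi> p \<beta>"
  proof (rule sharp_eqI[OF p])
    fix \<gamma> assume \<gamma>: "\<gamma> \<in> cotangent_space M p"
    show "\<gamma> (sharp M \<pi> p \<alpha> + sharp M \<pi> p \<beta>) = \<pi> p (\<alpha> + \<beta>) \<gamma>"
      using linear_between_add[OF bivector_linear_left[OF \<pi> p \<gamma>] \<alpha> \<beta>]
        linear_between_add[OF covec_linear[OF \<gamma>] sharp_tangent[OF \<pi> p \<alpha>] sharp_tangent[OF \<pi> p \<beta>]]
      by (simp add: covec_sharp[OF \<pi> p _ \<gamma>] \<alpha> \<beta>)
  qed (intro subspace_add[OF subspace_tangent] sharp_tangent[OF \<pi> p] \<alpha> \<beta>)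
next
  fix r \<alpha> assume \<alpha>: "\<alpha> \<in> cotangent_space M p"
  show "sharp M \<pi> p (r *\<^sub>R \<alpha>) = r *\<^sub>R sharp M \<pi> p \<alpha>"
  proof (rule sharp_eqI[OF p])
    fix \<gamma> assume \<gamma>: "\<gamma> \<in> cotangent_space M p"
    show "\<gamma> (r *\<^sub>R sharp M \<pi> p \<alpha>) = \<pi> p (r *\<^sub>R \<alpha>) \<gamma>"
      using linear_between_scale[OF bivector_linear_left[OF \<pi> p \<gamma>] \<alpha>]
        linear_between_scale[OF covec_linear[OF \<gamma>] sharp_tangent[OF \<pi> p \<alpha>]]
      by (simp add: covec_sharp[OF \<pi> p _ \<gamma>] \<alpha>)
  qed (intro subspace_scale[OF subspace_tangent] sharp_tangent[OF \<pi> p] \<alpha>)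
qed

lemma tangent_endo_linear:
  "tangent_endo M A \<Longrightarrow> p \<in> points M \<Longrightarrow>
    linear_between (tangent_space M p) (tangent_space M p) (A p)"
  by (simp add: tangent_endo_def)

lemma tangent_endo_mem:
  "tangent_endo M A \<Longrightarrow> p \<in> points M \<Longrightarrow> v \<in> tangent_space M p \<Longrightarrow> A p v \<in> tangent_space M p"
  by (rule linear_between_mem[OF tangent_endo_linear])

lemma tangent_endo_outside:
  "tangent_endo M A \<Longrightarrow> p \<notin> points M \<or> v \<notin> tangent_space M p \<Longrightarrow> A p v = 0"
  unfolding tangent_endo_def by blast

lemma tangent_endo_smooth:
  "tangent_endo M A \<Longrightarrow> c \<in> atlas M \<Longrightarrow> linear l \<Longrightarrow>
    smooth_in_chart c (\<lambda>p. l (A p (coord_vec M c a p) c))"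
  by (simp add: tangent_endo_def smooth_vector_field_in_def)

lemma dual_map_apply: "dual_map T \<alpha> v = \<alpha> (T v)"
  by (simp add: dual_map_def)

lemma dual_map_cotangent:
  assumes A: "tangent_endo M A" and p: "p \<in> points M" and \<alpha>: "\<alpha> \<in> cotangent_space M p"
  shows "dual_map (A p) \<alpha> \<in> cotangent_space M p"
  unfolding cotangent_space_def linear_between_def
  by (auto simp: dual_map_apply linear_between_add[OF tangent_endo_linear[OF A p]]
      linear_between_scale[OF tangent_endo_linear[OF A p]] tangent_endo_mem[OF A p]
      linear_between_add[OF covec_linear[OF \<alpha>]] linear_between_scale[OF covec_linear[OF \<alpha>]]
      tangent_endo_outside[OF A] covec_zero[OF \<alpha>])

lemma covec_minus:
  assumes "\<alpha> \<in> cotangent_space M p" "v \<in> tangent_space M p" shows "\<alpha> (- v) = - \<alpha> v"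
  using linear_between_scale[OF covec_linear[OF assms(1)] assms(2), of "-1"] by simp

lemma dual_map_add: "dual_map T (\<alpha> + \<beta>) = dual_map T \<alpha> + dual_map T \<beta>"
  by (rule ext) (simp add: dual_map_apply)

lemma dual_map_scale: "dual_map T (r *\<^sub>R \<alpha>) = r *\<^sub>R dual_map T \<alpha>"
  by (rule ext) (simp add: dual_map_apply scaleR_apply)

lemma dual_map_minus: "dual_map T (- \<alpha>) = - dual_map T \<alpha>"
  by (rule ext) (simp add: dual_map_apply)

lemma dual_map_zero: "dual_map T 0 = 0"
  by (rule ext) (simp add: dual_map_apply)

text \<open>The product of smooth components: \<open>\<pi>\<^sub>A(dl, dm) = \<Sum>\<^sub>b l(A \<partial>\<^sub>b) \<pi>(dx\<^sub>b, dm)\<close>.\<close>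

lemma twisted_bivector_smooth:
  assumes A: "tangent_endo M A" and \<pi>: "bivector_field M \<pi>"
    and c: "c \<in> atlas M" and l: "linear l" and m: "linear m"
  shows "smooth_in_chart c
    (\<lambda>p. twisted_bivector M A \<pi> p (coord_covec M c l p) (coord_covec M c m p))"
proof -
  obtain B and r :: "'e \<Rightarrow> 'e \<Rightarrow> real"
    where "finite B" and r: "\<And>b. linear (r b)" "\<And>x. x = (\<Sum>b\<in>B. r b x *\<^sub>R b)"
    by (rule model_dual_basis) (rule that)
  show ?thesis
  proof (rule smooth_in_chart_transfer[OF c])
    show "smooth_in_chart c (\<lambda>p. \<Sum>b\<in>B. l (A p (coord_vec M c b p) c) *
        \<pi> p (coord_covec M c (r b) p) (coord_covec M c m p))"
      by (intro smooth_in_chart_sum smooth_in_chart_mult open_chart_image[OF c]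
          tangent_endo_smooth[OF A c l] bivector_smooth[OF \<pi> c r(1) m])
    fix p assume cp: "c \<in> charts_at M p" and p: "p \<in> points M"
    let ?l = "coord_covec M c l p" and ?m = "coord_covec M c m p"
    have m': "?m \<in> cotangent_space M p" and l': "?l \<in> cotangent_space M p"
      using coord_covec_cotangent l m by blast+
    have dl: "dual_map (A p) ?l \<in> cotangent_space M p"
      by (rule dual_map_cotangent[OF A p l'])
    have coeff: "dual_map (A p) ?l (coord_vec M c b p) = l (A p (coord_vec M c b p) c)" for b
      by (simp add: dual_map_apply coord_covec_apply tangent_endo_mem[OF A p] coord_vec_tangent[OF cp])
    have "twisted_bivector M A \<pi> p ?l ?m = \<pi> p (dual_map (A p) ?l) ?m"
      using p l' m' by (simp add: twisted_bivector_def)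
    also have "dual_map (A p) ?l
        = (\<Sum>b\<in>B. l (A p (coord_vec M c b p) c) *\<^sub>R coord_covec M c (r b) p)"
      using covec_eq_sum[OF cp dl r] coeff by simp
    also have "\<pi> p \<dots> ?m = (\<Sum>b\<in>B. l (A p (coord_vec M c b p) c) *
        \<pi> p (coord_covec M c (r b) p) ?m)"
      by (subst linear_between_sum[OF bivector_linear_left[OF \<pi> p m'] subspace_cotangent])
        (simp_all add: subspace_scale[OF subspace_cotangent] coord_covec_cotangent r(1)
          linear_between_scale[OF bivector_linear_left[OF \<pi> p m']])
    finally show "(\<Sum>b\<in>B. l (A p (coord_vec M c b p) c) *
        \<pi> p (coord_covec M c (r b) p) ?m) = twisted_bivector M A \<pi> p ?l ?m" by simp
  qed
qed

lemma twisted_bivector_field: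
  assumes A: "tangent_endo M A" and \<pi>: "bivector_field M \<pi>"
    and skew: "\<And>p \<alpha> \<beta>. p \<in> points M \<Longrightarrow> \<alpha> \<in> cotangent_space M p \<Longrightarrow> \<beta> \<in> cotangent_space M p \<Longrightarrow>
      \<pi> p (dual_map (A p) \<alpha>) \<beta> = - \<pi> p (dual_map (A p) \<beta>) \<alpha>"
  shows "bivector_field M (twisted_bivector M A \<pi>)"
proof -
  have "linear_between (cotangent_space M p) UNIV (twisted_bivector M A \<pi> p \<alpha>)"
    "linear_between (cotangent_space M p) UNIV (\<lambda>\<beta>. twisted_bivector M A \<pi> p \<beta> \<alpha>)"
    if p: "p \<in> points M" and \<alpha>: "\<alpha> \<in> cotangent_space M p" for p \<alpha>
    using bivector_linear_right[OF \<pi> p dual_map_cotangent[OF A p \<alpha>]]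
      bivector_linear_left[OF \<pi> p \<alpha>] p \<alpha>
    by (simp_all add: linear_between_def twisted_bivector_def subspace_add[OF subspace_cotangent]
        subspace_scale[OF subspace_cotangent] dual_map_add dual_map_scale dual_map_cotangent[OF A p])
  moreover have "twisted_bivector M A \<pi> p \<alpha> \<beta> = - twisted_bivector M A \<pi> p \<beta> \<alpha>"
    if "p \<in> points M" "\<alpha> \<in> cotangent_space M p" "\<beta> \<in> cotangent_space M p" for p \<alpha> \<beta>
    using skew[OF that] that by (simp add: twisted_bivector_def)
  moreover have "twisted_bivector M A \<pi> p \<alpha> \<beta> = 0"
    if "p \<notin> points M \<or> \<alpha> \<notin> cotangent_space M p \<or> \<beta> \<notin> cotangent_space M p" for p \<alpha> \<beta>
    using that by (auto simp: twisted_bivector_def)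
  ultimately show ?thesis
    unfolding bivector_field_def using twisted_bivector_smooth[OF A \<pi>] by blast
qed

section \<open>From a compatible pair to a generalized F structure\<close>

lemma endo_of_pair_apply:
  "p \<in> points M \<Longrightarrow> v \<in> tangent_space M p \<Longrightarrow> \<alpha> \<in> cotangent_space M p \<Longrightarrow>
    endo_of_pair M A \<pi> p (v, \<alpha>) = (A p v + sharp M \<pi> p \<alpha>, - dual_map (A p) \<alpha>)"
  by (simp add: endo_of_pair_def big_tangent_iff)

lemma big_tangent_endo_of_pair:
  assumes A: "tangent_endo M A" and \<pi>: "bivector_field M \<pi>"
  shows "big_tangent_endo M (endo_of_pair M A \<pi>)"
  unfolding big_tangent_endo_def
proof (intro conjI ballI allI impI)
  fix p assume p: "p \<in> points M"
  note Al = tangent_endo_linear[OF A p] and sl = sharp_linear[OF \<pi> p]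
  show "linear_between (big_tangent_space M p) (big_tangent_space M p) (endo_of_pair M A \<pi> p)"
    unfolding linear_between_def
  proof (intro conjI ballI allI)
    show "endo_of_pair M A \<pi> p ` big_tangent_space M p \<subseteq> big_tangent_space M p"
      by (auto simp: big_tangent_iff endo_of_pair_apply[OF p] subspace_add[OF subspace_tangent]
          tangent_endo_mem[OF A p] sharp_tangent[OF \<pi> p] cotangent_minus dual_map_cotangent[OF A p])
  next
    fix u w assume "u \<in> big_tangent_space M p" "w \<in> big_tangent_space M p"
    then show "endo_of_pair M A \<pi> p (u + w) = endo_of_pair M A \<pi> p u + endo_of_pair M A \<pi> p w"
      by (cases u; cases w) (simp add: big_tangent_iff endo_of_pair_apply[OF p]
          subspace_add[OF subspace_tangent] subspace_add[OF subspace_cotangent]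
          linear_between_add[OF Al] linear_between_add[OF sl] dual_map_add)
  next
    fix r u assume "u \<in> big_tangent_space M p"
    then show "endo_of_pair M A \<pi> p (r *\<^sub>R u) = r *\<^sub>R endo_of_pair M A \<pi> p u"
      by (cases u) (simp add: big_tangent_iff endo_of_pair_apply[OF p]
          subspace_scale[OF subspace_tangent] subspace_scale[OF subspace_cotangent]
          linear_between_scale[OF Al] linear_between_scale[OF sl] dual_map_scale scaleR_right_distrib)
  qed
next
  fix p u assume "p \<notin> points M \<or> u \<notin> big_tangent_space M p"
  then show "endo_of_pair M A \<pi> p u = 0"
    by (cases u) (auto simp: endo_of_pair_def)
next
  fix c a assume c: "c \<in> atlas M"
  have *: "endo_of_pair M A \<pi> p (coord_vec M c a p, 0) = (A p (coord_vec M c a p), 0)"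
    if "c \<in> charts_at M p" "p \<in> points M" for p
    using that linear_between_zero[OF sharp_linear[OF \<pi>] subspace_cotangent]
    by (simp add: endo_of_pair_apply coord_vec_tangent cotangent_zero dual_map_zero)
  have "smooth_in_chart c (\<lambda>p. l (fst (endo_of_pair M A \<pi> p (coord_vec M c a p, 0)) c))"
    if "linear l" for l
    by (rule smooth_in_chart_transfer[OF c tangent_endo_smooth[OF A c that]]) (simp add: *)
  \<comment> \<open>The covector component vanishes; the zero function is the case \<open>l = 0\<close> of smoothness of \<open>A\<close>.\<close>
  moreover have "smooth_in_chart c
      (\<lambda>p. snd (endo_of_pair M A \<pi> p (coord_vec M c a p, 0)) (coord_vec M c b p))" for b
    by (rule smooth_in_chart_transfer[OF c tangent_endo_smooth[OF A c linear_zero]]) (simp add: *)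
  ultimately show "smooth_big_section_in M c (\<lambda>p. endo_of_pair M A \<pi> p (coord_vec M c a p, 0))"
    by (simp add: smooth_big_section_in_def smooth_vector_field_in_def smooth_one_form_in_def)
next
  fix c and l :: "'e \<Rightarrow> real" assume c: "c \<in> atlas M" and l: "linear l"
  have *: "endo_of_pair M A \<pi> p (0, coord_covec M c l p)
      = (sharp M \<pi> p (coord_covec M c l p), - dual_map (A p) (coord_covec M c l p))"
    if "p \<in> points M" for p
    using that linear_between_zero[OF tangent_endo_linear[OF A that] subspace_tangent]
    by (simp add: endo_of_pair_apply coord_covec_cotangent[OF l] tangent_zero)
  have "smooth_in_chart c (\<lambda>p. m (fst (endo_of_pair M A \<pi> p (0, coord_covec M c l p)) c))"
    if m: "linear m" for m
  proof (rule smooth_in_chart_transfer[OF c bivector_smooth[OF \<pi> c l m]])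
    fix p assume p: "p \<in> points M"
    note l' = coord_covec_cotangent[OF l, of c p] and m' = coord_covec_cotangent[OF m, of c p]
    show "\<pi> p (coord_covec M c l p) (coord_covec M c m p)
        = m (fst (endo_of_pair M A \<pi> p (0, coord_covec M c l p)) c)"
      using covec_sharp[OF \<pi> p l' m']
      by (simp add: *[OF p] coord_covec_apply[OF sharp_tangent[OF \<pi> p l']])
  qed
  moreover have "smooth_in_chart c
      (\<lambda>p. snd (endo_of_pair M A \<pi> p (0, coord_covec M c l p)) (coord_vec M c b p))" for b
  proof (rule smooth_in_chart_transfer[OF c tangent_endo_smooth[OF A c]])
    show "linear (\<lambda>x. - l x)" by (rule linear_compose_neg[OF l])
    fix p assume "c \<in> charts_at M p" and p: "p \<in> points M"
    then show "- l (A p (coord_vec M c b p) c)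
        = snd (endo_of_pair M A \<pi> p (0, coord_covec M c l p)) (coord_vec M c b p)"
      by (simp add: *[OF p] dual_map_apply coord_covec_apply tangent_endo_mem[OF A p] coord_vec_tangent)
  qed
  ultimately show "smooth_big_section_in M c (\<lambda>p. endo_of_pair M A \<pi> p (0, coord_covec M c l p))"
    by (simp add: smooth_big_section_in_def smooth_vector_field_in_def smooth_one_form_in_def)
qed

text \<open>Skew-symmetry of \<open>\<pi>\<^sub>A\<close> means that \<open>\<sharp>\<^sub>\<pi>\<close> intertwines \<open>A\<^sup>*\<close> and \<open>A\<close>.\<close>

lemma sharp_dual_map:
  assumes A: "tangent_endo M A" and \<pi>: "bivector_field M \<pi>"
    and tw: "bivector_field M (twisted_bivector M A \<pi>)"
    and p: "p \<in> points M" and \<alpha>: "\<alpha> \<in> cotangent_space M p"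
  shows "sharp M \<pi> p (dual_map (A p) \<alpha>) = A p (sharp M \<pi> p \<alpha>)"
proof (rule sharp_eqI[OF p])
  show "A p (sharp M \<pi> p \<alpha>) \<in> tangent_space M p"
    by (intro tangent_endo_mem[OF A p] sharp_tangent[OF \<pi> p \<alpha>])
  fix \<beta> assume \<beta>: "\<beta> \<in> cotangent_space M p"
  have "\<beta> (A p (sharp M \<pi> p \<alpha>)) = \<pi> p \<alpha> (dual_map (A p) \<beta>)"
    using covec_sharp[OF \<pi> p \<alpha> dual_map_cotangent[OF A p \<beta>]] by (simp add: dual_map_apply)
  also have "\<dots> = - \<pi> p (dual_map (A p) \<beta>) \<alpha>"
    by (rule bivector_skew[OF \<pi> p \<alpha> dual_map_cotangent[OF A p \<beta>]])
  also have "\<dots> = \<pi> p (dual_map (A p) \<alpha>) \<beta>"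
    using bivector_skew[OF tw p \<alpha> \<beta>] p \<alpha> \<beta> by (simp add: twisted_bivector_def)
  finally show "\<beta> (A p (sharp M \<pi> p \<alpha>)) = \<pi> p (dual_map (A p) \<alpha>) \<beta>" .
qed

lemma F_structure_tangent_endo: "F_structure M A \<Longrightarrow> tangent_endo M A"
  by (simp add: F_structure_def)

lemma F_structure_cube:
  "F_structure M A \<Longrightarrow> p \<in> points M \<Longrightarrow> v \<in> tangent_space M p \<Longrightarrow> A p (A p (A p v)) = - A p v"
  by (simp add: F_structure_def eq_neg_iff_add_eq_0)

lemma generalized_F_structure_of_pair:
  assumes F: "F_structure M A" and \<pi>: "bivector_field M \<pi>" and comp: "compatible_bivector M A \<pi>"
  shows "generalized_F_structure M (endo_of_pair M A \<pi>)" "quasi_classical M (endo_of_pair M A \<pi>)"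
proof -
  have A: "tangent_endo M A" using F by (simp add: F_structure_def)
  have tw: "bivector_field M (twisted_bivector M A \<pi>)"
    using comp by (simp add: compatible_bivector_def)
  let ?\<Phi> = "endo_of_pair M A \<pi>"
  note mem = tangent_endo_mem[OF A] sharp_tangent[OF \<pi>] dual_map_cotangent[OF A]
    subspace_add[OF subspace_tangent] cotangent_minus tangent_minus cotangent_zero tangent_zero
  have A0: "A p 0 = 0" and s0: "sharp M \<pi> p 0 = 0" if "p \<in> points M" for p
    using linear_between_zero[OF tangent_endo_linear[OF A that] subspace_tangent]
      linear_between_zero[OF sharp_linear[OF \<pi> that] subspace_cotangent] by simp_all
  have s_minus: "sharp M \<pi> p (- \<alpha>) = - sharp M \<pi> p \<alpha>"
    if "p \<in> points M" "\<alpha> \<in> cotangent_space M p" for p \<alpha>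
    using linear_between_scale[OF sharp_linear[OF \<pi> that(1)] that(2), of "-1"] by simp
  have sq: "?\<Phi> p (?\<Phi> p (v, \<alpha>)) = (A p (A p v), dual_map (A p) (dual_map (A p) \<alpha>))"
    if "p \<in> points M" "v \<in> tangent_space M p" "\<alpha> \<in> cotangent_space M p" for p v \<alpha>
    using that
    by (simp add: endo_of_pair_apply mem linear_between_add[OF tangent_endo_linear[OF A]]
        s_minus sharp_dual_map[OF A \<pi> tw] dual_map_minus)
  have sharp_sq: "A p (A p (sharp M \<pi> p \<alpha>)) = - sharp M \<pi> p \<alpha>"
    if p: "p \<in> points M" and \<alpha>: "\<alpha> \<in> cotangent_space M p" for p \<alpha>
  proof -
    obtain v where "v \<in> tangent_space M p" "sharp M \<pi> p \<alpha> = A p v"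
      using comp p \<alpha> unfolding compatible_bivector_def by blast
    then show ?thesis using F_structure_cube[OF F p] by simp
  qed
  have "pairing_metric (?\<Phi> p u) w + pairing_metric u (?\<Phi> p w) = 0"
    if p: "p \<in> points M" and u': "u \<in> big_tangent_space M p" and w': "w \<in> big_tangent_space M p"
    for p u w
  proof -
    obtain v \<alpha> where u: "u = (v, \<alpha>)" "v \<in> tangent_space M p" "\<alpha> \<in> cotangent_space M p"
      using u' by (cases u) (simp add: big_tangent_iff)
    obtain x \<beta> where w: "w = (x, \<beta>)" "x \<in> tangent_space M p" "\<beta> \<in> cotangent_space M p"
      using w' by (cases w) (simp add: big_tangent_iff)
    have "\<beta> (A p v + sharp M \<pi> p \<alpha>) = \<beta> (A p v) + \<pi> p \<alpha> \<beta>"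
      "\<alpha> (A p x + sharp M \<pi> p \<beta>) = \<alpha> (A p x) + \<pi> p \<beta> \<alpha>"
      using u w p by (simp_all add: linear_between_add[OF covec_linear] mem covec_sharp[OF \<pi>])
    then show ?thesis
      using bivector_skew[OF \<pi> p u(3) w(3)] u w p
      by (simp add: endo_of_pair_apply pairing_metric_def dual_map_apply flip: add_divide_distrib)
  qed
  moreover have "?\<Phi> p (?\<Phi> p (?\<Phi> p u)) + ?\<Phi> p u = 0"
    if p: "p \<in> points M" and u': "u \<in> big_tangent_space M p" for p u
  proof -
    obtain v \<alpha> where u: "u = (v, \<alpha>)" "v \<in> tangent_space M p" "\<alpha> \<in> cotangent_space M p"
      using u' by (cases u) (simp add: big_tangent_iff)
    have "dual_map (A p) (dual_map (A p) (dual_map (A p) \<alpha>)) = - dual_map (A p) \<alpha>"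
    proof
      \<comment> \<open>Outside the tangent space, \<open>A\<close> and hence both sides are 0.\<close>
      fix x show "dual_map (A p) (dual_map (A p) (dual_map (A p) \<alpha>)) x = (- dual_map (A p) \<alpha>) x"
        using F_structure_cube[OF F p] covec_minus[OF u(3)] tangent_endo_mem[OF A p]
          tangent_endo_outside[OF A] A0[OF p] covec_zero[OF u(3)]
        by (cases "x \<in> tangent_space M p") (simp_all add: dual_map_apply)
    qed
    moreover have "?\<Phi> p (?\<Phi> p (?\<Phi> p u))
        = ?\<Phi> p (A p (A p v), dual_map (A p) (dual_map (A p) \<alpha>))"
      using u p by (simp add: sq)
    ultimately show ?thesis
      using u p
      by (simp add: endo_of_pair_apply mem F_structure_cube[OF F p] sharp_dual_map[OF A \<pi> tw p]
          sharp_sq zero_prod_def)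
  qed
  ultimately show "generalized_F_structure M ?\<Phi>"
    using big_tangent_endo_of_pair[OF A \<pi>] unfolding generalized_F_structure_def by blast
  show "quasi_classical M ?\<Phi>"
    unfolding quasi_classical_def
  proof (intro ballI conjI)
    fix p assume p: "p \<in> points M"
    show "?\<Phi> p ` (tangent_space M p \<times> {0}) \<subseteq> tangent_space M p \<times> {0}"
      using p by (auto simp: endo_of_pair_apply mem s0 dual_map_zero)
    show "(?\<Phi> p \<circ> ?\<Phi> p) ` ({0} \<times> cotangent_space M p) \<subseteq> {0} \<times> cotangent_space M p"
    proof
      fix u assume "u \<in> (?\<Phi> p \<circ> ?\<Phi> p) ` ({0} \<times> cotangent_space M p)"
      then obtain \<alpha> where "\<alpha> \<in> cotangent_space M p" "u = ?\<Phi> p (?\<Phi> p (0, \<alpha>))"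
        by auto
      then show "u \<in> {0} \<times> cotangent_space M p"
        using p by (simp add: sq mem A0)
    qed
  qed
qed

section \<open>From a generalized F structure to a compatible pair\<close>

text \<open>The block \<open>TM \<rightarrow> TM\<close> of an endomorphism of the big tangent bundle, extended by 0.\<close>

definition tangent_part ::
    "('a \<Rightarrow> ('a, 'e) tvec \<times> ('a, 'e) covec \<Rightarrow> ('a, 'e) tvec \<times> ('a, 'e) covec) \<Rightarrow>
     'a \<Rightarrow> ('a, 'e) tvec \<Rightarrow> ('a, 'e) tvec"
  where "tangent_part \<Phi> p v =
    (if p \<in> points M \<and> v \<in> tangent_space M p then fst (\<Phi> p (v, 0)) else 0)"

text \<open>The block \<open>\<sigma>: T\<^sup>*M \<rightarrow> TM\<close>, read as the form \<open>(\<alpha>, \<beta>) \<mapsto> \<beta>(\<sigma> \<alpha>)\<close> on covectors and extended by 0; it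
  is a bivector field when the endomorphism is smooth and skew-symmetric for the pairing metric.\<close>

definition bivector_part ::
    "('a \<Rightarrow> ('a, 'e) tvec \<times> ('a, 'e) covec \<Rightarrow> ('a, 'e) tvec \<times> ('a, 'e) covec) \<Rightarrow>
     'a \<Rightarrow> ('a, 'e) covec \<Rightarrow> ('a, 'e) covec \<Rightarrow> real"
  where "bivector_part \<Phi> p \<alpha> \<beta> =
    (if p \<in> points M \<and> \<alpha> \<in> cotangent_space M p \<and> \<beta> \<in> cotangent_space M p
     then \<beta> (fst (\<Phi> p (0, \<alpha>))) else 0)"

lemma tangent_part_endo_of_pair:
  assumes A: "tangent_endo M A" and \<pi>: "bivector_field M \<pi>"
  shows "tangent_part (endo_of_pair M A \<pi>) = A"
proof (rule ext, rule ext)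
  show "tangent_part (endo_of_pair M A \<pi>) p v = A p v" for p v
    using tangent_endo_outside[OF A, of p v]
      linear_between_zero[OF sharp_linear[OF \<pi>] subspace_cotangent]
    by (auto simp: tangent_part_def endo_of_pair_apply cotangent_zero)
qed

lemma bivector_part_endo_of_pair:
  assumes A: "tangent_endo M A" and \<pi>: "bivector_field M \<pi>"
  shows "bivector_part (endo_of_pair M A \<pi>) = \<pi>"
proof (intro ext)
  show "bivector_part (endo_of_pair M A \<pi>) p \<alpha> \<beta> = \<pi> p \<alpha> \<beta>" for p \<alpha> \<beta>
    using bivector_outside[OF \<pi>, of p \<alpha> \<beta>] covec_sharp[OF \<pi>, of p \<alpha> \<beta>]
      linear_between_zero[OF tangent_endo_linear[OF A] subspace_tangent]
    by (auto simp: bivector_part_def endo_of_pair_apply tangent_zero)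
qed

text \<open>In the proof, \<open>\<sigma>\<close> is the block \<open>T\<^sup>*M \<rightarrow> TM\<close> of \<open>\<Phi>\<close>, which turns out to be \<open>\<sharp>\<^sub>\<pi>\<close>.\<close>

lemma pair_of_generalized_F_structure:
  assumes gen: "generalized_F_structure M \<Phi>" and qc: "quasi_classical M \<Phi>"
  defines "A \<equiv> tangent_part \<Phi>" and "\<pi> \<equiv> bivector_part \<Phi>"
  shows "F_structure M A" "bivector_field M \<pi>" "compatible_bivector M A \<pi>"
    "endo_of_pair M A \<pi> = \<Phi>"
proof -
  define \<sigma> where "\<sigma> p \<alpha> = fst (\<Phi> p (0, \<alpha>))" for p \<alpha>
  have big: "big_tangent_endo M \<Phi>"
    using gen by (simp add: generalized_F_structure_def)
  have lin: "linear_between (big_tangent_space M p) (big_tangent_space M p) (\<Phi> p)"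
    if "p \<in> points M" for p
    using big that by (simp add: big_tangent_endo_def)
  note big_simps = big_tangent_iff tangent_zero cotangent_zero
  have \<Phi>_vec: "\<Phi> p (v, 0) = (A p v, 0)" and A_mem: "A p v \<in> tangent_space M p"
    if "p \<in> points M" "v \<in> tangent_space M p" for p v
  proof -
    have "\<Phi> p (v, 0) \<in> tangent_space M p \<times> {0}"
      using qc that unfolding quasi_classical_def by blast
    then show "\<Phi> p (v, 0) = (A p v, 0)" "A p v \<in> tangent_space M p"
      using that by (auto simp: A_def tangent_part_def)
  qed
  have \<sigma>_mem: "\<sigma> p \<alpha> \<in> tangent_space M p" if "p \<in> points M" "\<alpha> \<in> cotangent_space M p" for p \<alpha>
    using linear_between_mem[OF lin[OF that(1)], of "(0, \<alpha>)"] that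
    by (cases "\<Phi> p (0, \<alpha>)") (simp add: \<sigma>_def big_simps)
  have \<pi>_apply: "\<pi> p \<alpha> \<beta> = \<beta> (\<sigma> p \<alpha>)"
    if "p \<in> points M" "\<alpha> \<in> cotangent_space M p" "\<beta> \<in> cotangent_space M p" for p \<alpha> \<beta>
    using that by (simp add: \<pi>_def bivector_part_def \<sigma>_def)
  have skew: "pairing_metric (\<Phi> p u) w + pairing_metric u (\<Phi> p w) = 0"
    if "p \<in> points M" "u \<in> big_tangent_space M p" "w \<in> big_tangent_space M p" for p u w
    using gen that by (simp add: generalized_F_structure_def)
  have cube: "\<Phi> p (\<Phi> p (\<Phi> p u)) + \<Phi> p u = 0"
    if "p \<in> points M" "u \<in> big_tangent_space M p" for p u
    using gen that by (simp add: generalized_F_structure_def)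

  have A_add: "A p (v + w) = A p v + A p w"
    if "p \<in> points M" "v \<in> tangent_space M p" "w \<in> tangent_space M p" for p v w
    using linear_between_add[OF lin[OF that(1)], of "(v, 0)" "(w, 0)"] that
    by (simp add: big_simps \<Phi>_vec subspace_add[OF subspace_tangent])
  have A_scale: "A p (r *\<^sub>R v) = r *\<^sub>R A p v"
    if "p \<in> points M" "v \<in> tangent_space M p" for p v r
    using linear_between_scale[OF lin[OF that(1)], of "(v, 0)" r] that
    by (simp add: big_simps \<Phi>_vec subspace_scale[OF subspace_tangent])
  have A: "tangent_endo M A"
    unfolding tangent_endo_def
  proof (intro conjI ballI allI impI)
    show "linear_between (tangent_space M p) (tangent_space M p) (A p)" if "p \<in> points M" for p
      unfolding linear_between_def using that A_mem A_add A_scale by blast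
    show "A p v = 0" if "p \<notin> points M \<or> v \<notin> tangent_space M p" for p v
      using that by (auto simp: A_def tangent_part_def)
    fix c a assume c: "c \<in> atlas M"
    have sm: "smooth_in_chart c (\<lambda>p. l (fst (\<Phi> p (coord_vec M c a p, 0)) c))" if "linear l" for l
      using big c that unfolding big_tangent_endo_def smooth_big_section_in_def
        smooth_vector_field_in_def by blast
    show "smooth_vector_field_in c (\<lambda>p. A p (coord_vec M c a p))"
      unfolding smooth_vector_field_in_def
    proof (intro allI impI)
      show "smooth_in_chart c (\<lambda>p. l (A p (coord_vec M c a p) c))" if "linear l" for l
        by (rule smooth_in_chart_transfer[OF c sm[OF that]]) (simp add: \<Phi>_vec coord_vec_tangent)
    qed
  qed
  have A0: "A p 0 = 0" if "p \<in> points M" for p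
    by (rule linear_between_zero[OF tangent_endo_linear[OF A that] subspace_tangent])
  have A_minus: "A p (- v) = - A p v" if "p \<in> points M" "v \<in> tangent_space M p" for p v
    using A_scale[OF that, of "-1"] by simp
  show F: "F_structure M A"
    unfolding F_structure_def
  proof (intro conjI A ballI)
    show "A p (A p (A p v)) + A p v = 0" if "p \<in> points M" "v \<in> tangent_space M p" for p v
      using cube[of p "(v, 0)"] that by (simp add: big_simps \<Phi>_vec A_mem zero_prod_def)
  qed

  have \<Phi>_covec: "\<Phi> p (0, \<alpha>) = (\<sigma> p \<alpha>, - dual_map (A p) \<alpha>)"
    if p: "p \<in> points M" and \<alpha>: "\<alpha> \<in> cotangent_space M p" for p \<alpha>
  proof -
    have mem: "snd (\<Phi> p (0, \<alpha>)) \<in> cotangent_space M p"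
      using linear_between_mem[OF lin[OF that(1)], of "(0, \<alpha>)"] that
      by (cases "\<Phi> p (0, \<alpha>)") (simp add: big_simps)
    \<comment> \<open>Skew-symmetry, applied to a covector and a vector, determines the block \<open>T\<^sup>*M \<rightarrow> T\<^sup>*M\<close>.\<close>
    have "snd (\<Phi> p (0, \<alpha>)) = - dual_map (A p) \<alpha>"
    proof (rule covec_eqI[OF mem])
      show "- dual_map (A p) \<alpha> \<in> cotangent_space M p"
        by (intro cotangent_minus dual_map_cotangent[OF A p \<alpha>])
      show "snd (\<Phi> p (0, \<alpha>)) v = (- dual_map (A p) \<alpha>) v" if v: "v \<in> tangent_space M p" for v
        using skew[of p "(0, \<alpha>)" "(v, 0)"] p \<alpha> v
        by (simp add: big_simps \<Phi>_vec pairing_metric_def dual_map_apply eq_neg_iff_add_eq_0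
            flip: add_divide_distrib)
    qed
    then show ?thesis by (simp add: \<sigma>_def prod_eq_iff)
  qed
  have \<sigma>_add: "\<sigma> p (\<alpha> + \<beta>) = \<sigma> p \<alpha> + \<sigma> p \<beta>"
    if "p \<in> points M" "\<alpha> \<in> cotangent_space M p" "\<beta> \<in> cotangent_space M p" for p \<alpha> \<beta>
    using linear_between_add[OF lin[OF that(1)], of "(0, \<alpha>)" "(0, \<beta>)"] that
    by (simp add: big_simps \<sigma>_def)
  have \<sigma>_scale: "\<sigma> p (r *\<^sub>R \<alpha>) = r *\<^sub>R \<sigma> p \<alpha>"
    if "p \<in> points M" "\<alpha> \<in> cotangent_space M p" for p \<alpha> r
    using linear_between_scale[OF lin[OF that(1)], of "(0, \<alpha>)" r] that
    by (simp add: big_simps \<sigma>_def)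
  have \<sigma>_minus: "\<sigma> p (- \<alpha>) = - \<sigma> p \<alpha>" if "p \<in> points M" "\<alpha> \<in> cotangent_space M p" for p \<alpha>
    using \<sigma>_scale[OF that, of "-1"] by simp
  have \<Phi>_apply: "\<Phi> p (v, \<alpha>) = (A p v + \<sigma> p \<alpha>, - dual_map (A p) \<alpha>)"
    if "p \<in> points M" "v \<in> tangent_space M p" "\<alpha> \<in> cotangent_space M p" for p v \<alpha>
    using linear_between_add[OF lin[OF that(1)], of "(v, 0)" "(0, \<alpha>)"] that
    by (simp add: big_simps \<Phi>_vec \<Phi>_covec)
  \<comment> \<open>Skew-symmetry, applied to two covectors.\<close>
  have \<pi>_skew: "\<pi> p \<alpha> \<beta> = - \<pi> p \<beta> \<alpha>"
    if "p \<in> points M" "\<alpha> \<in> cotangent_space M p" "\<beta> \<in> cotangent_space M p" for p \<alpha> \<beta>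
    using skew[of p "(0, \<alpha>)" "(0, \<beta>)"] that
    by (simp add: big_simps \<Phi>_covec pairing_metric_def dual_map_apply A0 covec_zero \<pi>_apply
        eq_neg_iff_add_eq_0 flip: add_divide_distrib)
  show \<pi>: "bivector_field M \<pi>"
    unfolding bivector_field_def
  proof (intro conjI ballI allI impI)
    fix p \<alpha> assume p: "p \<in> points M" and \<alpha>: "\<alpha> \<in> cotangent_space M p"
    show "linear_between (cotangent_space M p) UNIV (\<pi> p \<alpha>)"
      unfolding linear_between_def using p \<alpha>
      by (simp add: \<pi>_apply subspace_add[OF subspace_cotangent] subspace_scale[OF subspace_cotangent]
          scaleR_apply)
    show "linear_between (cotangent_space M p) UNIV (\<lambda>\<beta>. \<pi> p \<beta> \<alpha>)"
      unfolding linear_between_def using p \<alpha>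
      by (simp add: \<pi>_apply subspace_add[OF subspace_cotangent] subspace_scale[OF subspace_cotangent]
          \<sigma>_add \<sigma>_scale \<sigma>_mem linear_between_add[OF covec_linear] linear_between_scale[OF covec_linear])
  next
    show "\<pi> p \<alpha> \<beta> = 0"
      if "p \<notin> points M \<or> \<alpha> \<notin> cotangent_space M p \<or> \<beta> \<notin> cotangent_space M p" for p \<alpha> \<beta>
      using that by (auto simp: \<pi>_def bivector_part_def)
  next
    fix c and l m :: "'e \<Rightarrow> real" assume c: "c \<in> atlas M" and l: "linear l" and m: "linear m"
    have sm: "smooth_in_chart c (\<lambda>p. m (fst (\<Phi> p (0, coord_covec M c l p)) c))"
      using big c l m unfolding big_tangent_endo_def smooth_big_section_in_def
        smooth_vector_field_in_def by blast
    show "smooth_in_chart c (\<lambda>p. \<pi> p (coord_covec M c l p) (coord_covec M c m p))"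
      by (rule smooth_in_chart_transfer[OF c sm])
        (simp add: \<pi>_apply \<Phi>_covec coord_covec_cotangent l m coord_covec_apply \<sigma>_mem)
  qed (rule \<pi>_skew)
  have sharp_eq: "sharp M \<pi> p \<alpha> = \<sigma> p \<alpha>" if "p \<in> points M" "\<alpha> \<in> cotangent_space M p" for p \<alpha>
    using that by (intro sharp_eqI) (simp_all add: \<sigma>_mem \<pi>_apply)

  have sq: "\<Phi> p (\<Phi> p (0, \<alpha>)) = (0, dual_map (A p) (dual_map (A p) \<alpha>))"
    and commute: "\<sigma> p (dual_map (A p) \<alpha>) = A p (\<sigma> p \<alpha>)"
    if p: "p \<in> points M" and \<alpha>: "\<alpha> \<in> cotangent_space M p" for p \<alpha>
  proof -
    have eq: "\<Phi> p (\<Phi> p (0, \<alpha>))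
        = (A p (\<sigma> p \<alpha>) - \<sigma> p (dual_map (A p) \<alpha>), dual_map (A p) (dual_map (A p) \<alpha>))"
      using p \<alpha> by (simp add: \<Phi>_covec \<Phi>_apply \<sigma>_mem cotangent_minus dual_map_cotangent[OF A]
          \<sigma>_minus dual_map_minus)
    have "(\<Phi> p \<circ> \<Phi> p) (0, \<alpha>) \<in> {0} \<times> cotangent_space M p"
      using qc p \<alpha> unfolding quasi_classical_def by blast
    then show "\<sigma> p (dual_map (A p) \<alpha>) = A p (\<sigma> p \<alpha>)" by (simp add: eq)
    then show "\<Phi> p (\<Phi> p (0, \<alpha>)) = (0, dual_map (A p) (dual_map (A p) \<alpha>))" by (simp add: eq)
  qed
  have "bivector_field M (twisted_bivector M A \<pi>)"
  proof (rule twisted_bivector_field[OF A \<pi>])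
    fix p \<alpha> \<beta>
    assume p: "p \<in> points M" and \<alpha>: "\<alpha> \<in> cotangent_space M p" and \<beta>: "\<beta> \<in> cotangent_space M p"
    have "\<pi> p (dual_map (A p) \<alpha>) \<beta> = \<pi> p \<alpha> (dual_map (A p) \<beta>)"
      using p \<alpha> \<beta> by (simp add: \<pi>_apply dual_map_cotangent[OF A] commute dual_map_apply)
    then show "\<pi> p (dual_map (A p) \<alpha>) \<beta> = - \<pi> p (dual_map (A p) \<beta>) \<alpha>"
      using \<pi>_skew[OF p \<alpha> dual_map_cotangent[OF A p \<beta>]] by simp
  qed
  moreover have "sharp M \<pi> p \<alpha> \<in> A p ` tangent_space M p"
    if p: "p \<in> points M" and \<alpha>: "\<alpha> \<in> cotangent_space M p" for p \<alpha>
  proof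
    \<comment> \<open>The vector component of \<open>\<Phi>\<^sup>3 + \<Phi> = 0\<close> on covectors gives \<open>\<sigma> \<alpha> = A (- A \<sigma> \<alpha>)\<close>.\<close>
    have "\<sigma> p (dual_map (A p) (dual_map (A p) \<alpha>)) + \<sigma> p \<alpha> = 0"
      using cube[of p "(0, \<alpha>)"] p \<alpha>
      by (simp add: big_simps sq) (simp add: \<Phi>_covec dual_map_cotangent[OF A] zero_prod_def)
    then have "A p (A p (\<sigma> p \<alpha>)) + \<sigma> p \<alpha> = 0"
      using p \<alpha> by (simp add: commute dual_map_cotangent[OF A])
    then show "sharp M \<pi> p \<alpha> = A p (- A p (\<sigma> p \<alpha>))"
      using p \<alpha> by (simp add: sharp_eq A_minus A_mem \<sigma>_mem add_eq_0_iff)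
    show "- A p (\<sigma> p \<alpha>) \<in> tangent_space M p"
      using p \<alpha> by (intro tangent_minus A_mem \<sigma>_mem)
  qed
  ultimately show "compatible_bivector M A \<pi>"
    unfolding compatible_bivector_def by blast
  show "endo_of_pair M A \<pi> = \<Phi>"
  proof (intro ext)
    fix p and u :: "('a, 'e) tvec \<times> ('a, 'e) covec"
    have out: "\<Phi> p u = 0" if "p \<notin> points M \<or> u \<notin> big_tangent_space M p"
      using big that unfolding big_tangent_endo_def by blast
    obtain v \<alpha> where u: "u = (v, \<alpha>)" by (cases u)
    show "endo_of_pair M A \<pi> p u = \<Phi> p u"
      using out unfolding u
      by (auto simp: endo_of_pair_def big_tangent_iff \<Phi>_apply sharp_eq)
  qed
qed

end

theorem proposition2p1:
  fixes M :: "('a, 'e::real_normed_vector) manifold"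
  assumes "smooth_manifold M"
  shows "bij_betw (\<lambda>(A, \<pi>). endo_of_pair M A \<pi>)
    {(A, \<pi>). F_structure M A \<and> bivector_field M \<pi> \<and> compatible_bivector M A \<pi>}
    {\<Phi>. generalized_F_structure M \<Phi> \<and> quasi_classical M \<Phi>}"
proof (rule bij_betwI[where g = "\<lambda>\<Phi>. (tangent_part M \<Phi>, bivector_part M \<Phi>)"])
qed (auto simp: generalized_F_structure_of_pair[OF assms] pair_of_generalized_F_structure[OF assms]
    tangent_part_endo_of_pair[OF assms] bivector_part_endo_of_pair[OF assms]
    dest: F_structure_tangent_endo[OF assms])

end
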